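(* Let $K$ be a nonempty compact Hausdorff space and let $f, g\in \mathcal{C}(K)$. Put $M_f = \{x\in K : |f(x)| = \|f\|\}$. Then the following statements are equivalent: (i) There exists a probability measure $\mu$ on $K$ with support contained in the norm attaining set $M_f$ such that $$\Big|\int_K \overline{f(x)}\,g(x)\,d\mu(x)\Big| = \|f\|\,\|g\|.$$ (ii) $f\parallel g$, i.e. there is $\lambda\in\mathbb{T}$ with $\|f+\lambda g\| = \|f\|+\|g\|$.
   Context: $\mathbb{T}=\{\lambda\in\mathbb{C}:|\lambda|=1\}$. $\mathcal{C}(K)$ is the Banach space of all continuous complex-valued functions on $K$ with norm $\|f\|=\max_{x\in K}|f(x)|$. In a normed space $X$, an element $x$ is norm-parallel to $y$, written $x\parallel y$, if $\|x+\lambda y\|=\|x\|+\|y\|$ for some $\lambda\in\mathbb{T}$. A probability measure is a positive measure of total mass $1$; measures on $K$ are regular Borel measures (elements of the dual of $\mathcal{C}(K)$). *)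

theory Defs
  imports "HOL-Probability.Probability"
begin

text \<open>
  A compact Hausdorff space \<open>K\<close> is a type of class \<^class>\<open>t2_space\<close> whose
  universe is compact. The library type of bounded continuous functions from \<open>K\<close> to
  the complex numbers, with its supremum norm, is then the Banach space of all continuous
  functions on \<open>K\<close> with the maximum norm, as the next two lemmas confirm.
\<close>

lemma continuous_in_bcontfun:
  fixes h :: "'k::t2_space \<Rightarrow> complex"
  assumes "compact (UNIV :: 'k set)" and "continuous_on UNIV h"
  shows "h \<in> bcontfun"
  using assms by (auto simp: bcontfun_def intro!: compact_imp_bounded compact_continuous_image)

lemma norm_bcontfun_is_max:
  fixes f :: "'k::t2_space \<Rightarrow>\<^sub>C complex"
  assumes "compact (UNIV :: 'k set)"
  shows "\<exists>x. norm f = cmod (f x) \<and> (\<forall>y. cmod (f y) \<le> cmod (f x))"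
proof -
  have "continuous_on UNIV (\<lambda>x. cmod (f x))"
    by (intro continuous_intros) auto
  then obtain x where x: "\<And>y. cmod (f y) \<le> cmod (f x)"
    using continuous_attains_sup[OF assms, of "\<lambda>x. cmod (f x)"] by auto
  have "norm f \<le> cmod (f x)"
    by (rule norm_bound) (rule x)
  moreover have "cmod (f x) \<le> norm f"
    by (rule norm_bounded)
  ultimately show ?thesis
    using x by (intro exI[of _ x]) auto
qed

text \<open>The library provides only real scalar multiplication on this function space.\<close>

definition scaleC_bcontfun ::
  "complex \<Rightarrow> ('k::topological_space \<Rightarrow>\<^sub>C complex) \<Rightarrow> ('k \<Rightarrow>\<^sub>C complex)"
  where "scaleC_bcontfun c f = Bcontfun (\<lambda>x. c * f x)"

lemma scaleC_bcontfun_apply [simp]: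
  fixes f :: "'k::topological_space \<Rightarrow>\<^sub>C complex"
  shows "scaleC_bcontfun c f x = c * f x"
proof -
  have cont: "continuous_on UNIV (apply_bcontfun f)" and bdd: "bounded (range (apply_bcontfun f))"
    using apply_bcontfun[of f] by (auto simp: bcontfun_def)
  have "bounded ((\<lambda>z. c * z) ` range (apply_bcontfun f))"
    by (intro bounded_linear_image bdd bounded_linear_mult_right)
  then have "(\<lambda>x. c * f x) \<in> bcontfun"
    using cont by (auto simp: bcontfun_def image_image intro!: continuous_intros)
  then show ?thesis
    by (simp add: scaleC_bcontfun_def Bcontfun_inverse)
qed

definition norm_parallel ::
  "('k::topological_space \<Rightarrow>\<^sub>C complex) \<Rightarrow> ('k \<Rightarrow>\<^sub>C complex) \<Rightarrow> bool"  (infix "\<parallel>" 50)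
  where "f \<parallel> g \<longleftrightarrow>
    (\<exists>c::complex. cmod c = 1 \<and> norm (f + scaleC_bcontfun c g) = norm f + norm g)"

definition norm_attaining_set :: "('k::topological_space \<Rightarrow>\<^sub>C complex) \<Rightarrow> 'k set"
  where "norm_attaining_set f = {x. cmod (f x) = norm f}"

definition regular_borel_measure :: "'k::topological_space measure \<Rightarrow> bool"
  where "regular_borel_measure \<mu> \<longleftrightarrow>
    sets \<mu> = sets borel \<and>
    (\<forall>A\<in>sets borel.
       emeasure \<mu> A = (INF U\<in>{U. open U \<and> A \<subseteq> U}. emeasure \<mu> U) \<and>
       emeasure \<mu> A = (SUP C\<in>{C. compact C \<and> C \<subseteq> A}. emeasure \<mu> C))"

definition measure_support :: "'k::topological_space measure \<Rightarrow> 'k set"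
  where "measure_support \<mu> = {x. \<forall>U. open U \<and> x \<in> U \<longrightarrow> emeasure \<mu> U > 0}"

end

theory Submission
  imports Defs
begin

text \<open>
  Both statements say that \<open>\<bar>f\<bar>\<close> and \<open>\<bar>g\<bar>\<close> attain their maxima at a common point:
  at such a point the phases can be aligned by a unimodular factor, and the Dirac measure there
  is the required \<open>\<mu>\<close>. Conversely, a measure as in (i) forces
  \<open>\<bar>f\<bar> \<bar>g\<bar> = \<parallel>f\<parallel> \<parallel>g\<parallel>\<close> almost everywhere.
\<close>

text \<open>The quotient of the phases rotates \<open>b\<close> into the direction of
  \<open>a\<close>, so \<open>c * b\<close> equals \<open>cmod b\<close> times \<open>sgn a\<close>
  and the moduli add. If \<open>a\<close> or \<open>b\<close> vanishes, every unimodular factor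
  works.\<close>

lemma unimodular_alignment:
  fixes a b :: complex
  obtains c where "cmod c = 1" "cmod (a + c * b) = cmod a + cmod b"
proof (cases "a = 0 \<or> b = 0")
  case True
  then show ?thesis by (intro that[of 1]) auto
next
  case False
  define c where "c = sgn a / sgn b"
  have "b = of_real (cmod b) * sgn b" "a = of_real (cmod a) * sgn a"
    using False by (auto simp: sgn_eq)
  moreover have "sgn b \<noteq> 0"
    using False by (simp add: sgn_zero_iff)
  ultimately have "a + c * b = of_real (cmod a + cmod b) * sgn a"
    unfolding c_def by (simp add: field_simps)
  then have "cmod (a + c * b) = cmod a + cmod b"
    using False by (simp only: norm_mult norm_of_real norm_sgn) auto
  moreover have "cmod c = 1"
    using False by (simp add: c_def norm_divide norm_sgn)
  ultimately show ?thesis by (intro that)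
qed

lemma norm_parallel_iff_common_max:
  fixes f g :: "'k::t2_space \<Rightarrow>\<^sub>C complex"
  assumes "compact (UNIV :: 'k set)"
  shows "f \<parallel> g \<longleftrightarrow> (\<exists>x. cmod (f x) = norm f \<and> cmod (g x) = norm g)"
proof
  assume "f \<parallel> g"
  then obtain c where c: "cmod c = 1" "norm (f + scaleC_bcontfun c g) = norm f + norm g"
    by (auto simp: norm_parallel_def)
  obtain x where x: "norm (f + scaleC_bcontfun c g) = cmod ((f + scaleC_bcontfun c g) x)"
    using norm_bcontfun_is_max[OF assms] by blast
  have "norm f + norm g = cmod (f x + c * g x)"
    using c x by simp
  also have "\<dots> \<le> cmod (f x) + cmod (g x)"
    using norm_triangle_ineq[of "f x" "c * g x"] c by (simp add: norm_mult)
  finally have "norm f + norm g \<le> cmod (f x) + cmod (g x)" .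
  then show "\<exists>x. cmod (f x) = norm f \<and> cmod (g x) = norm g"
    \<comment> \<open>Each modulus is at most the corresponding norm, so the inequality between the
      sums leaves no slack in either.\<close>
    using norm_bounded[of f x] norm_bounded[of g x] by (intro exI[of _ x]) linarith
next
  assume "\<exists>x. cmod (f x) = norm f \<and> cmod (g x) = norm g"
  then obtain x where x: "cmod (f x) = norm f" "cmod (g x) = norm g"
    by blast
  obtain c where c: "cmod c = 1" "cmod (f x + c * g x) = norm f + norm g"
    using unimodular_alignment[of "f x" "g x"] x by metis
  \<comment> \<open>The upper bound holds for every unimodular \<open>c\<close>; the alignment at
    \<open>x\<close> is what makes the lower bound hold.\<close>
  have "norm (f + scaleC_bcontfun c g) \<le> norm f + norm g"
  proof (rule norm_bound)
    fix y
    have "cmod (f y + c * g y) \<le> cmod (f y) + cmod (g y)"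
      using norm_triangle_ineq[of "f y" "c * g y"] c by (simp add: norm_mult)
    then show "cmod ((f + scaleC_bcontfun c g) y) \<le> norm f + norm g"
      using norm_bounded[of f y] norm_bounded[of g y] by simp
  qed
  moreover have "norm f + norm g \<le> norm (f + scaleC_bcontfun c g)"
    using norm_bounded[of "f + scaleC_bcontfun c g" x] c by simp
  ultimately show "f \<parallel> g"
    using c by (auto simp: norm_parallel_def)
qed

lemma regular_borel_measure_dirac:
  fixes x :: "'k::t2_space"
  shows "regular_borel_measure (return borel x)"
  unfolding regular_borel_measure_def
proof (intro conjI ballI)
  fix A :: "'k set"
  assume A: "A \<in> sets borel"
  show "emeasure (return borel x) A
      = (INF U\<in>{U. open U \<and> A \<subseteq> U}. emeasure (return borel x) U)"
  proof (rule antisym)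
    show "emeasure (return borel x) A \<le> (INF U\<in>{U. open U \<and> A \<subseteq> U}. emeasure (return borel x) U)"
      by (intro INF_greatest emeasure_mono) auto
    show "(INF U\<in>{U. open U \<and> A \<subseteq> U}. emeasure (return borel x) U) \<le> emeasure (return borel x) A"
      \<comment> \<open>The infimum is attained: if \<open>x\<close> lies outside \<open>A\<close>,
        the set \<open>- {x}\<close> is a null superset of \<open>A\<close>, open because points are
        closed in a Hausdorff space.\<close>
      by (rule INF_lower2[of "if x \<in> A then UNIV else - {x}"])
        (use A in \<open>auto simp: emeasure_return\<close>)
  qed
  show "emeasure (return borel x) A
      = (SUP C\<in>{C. compact C \<and> C \<subseteq> A}. emeasure (return borel x) C)"
  proof (rule antisym)
    show "(SUP C\<in>{C. compact C \<and> C \<subseteq> A}. emeasure (return borel x) C) \<le> emeasure (return borel x) A"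
      using A by (intro SUP_least emeasure_mono) auto
    show "emeasure (return borel x) A \<le> (SUP C\<in>{C. compact C \<and> C \<subseteq> A}. emeasure (return borel x) C)"
      \<comment> \<open>The supremum is attained as well, since a single point is compact and
        carries the whole mass.\<close>
      by (rule SUP_upper2[of "if x \<in> A then {x} else {}"])
        (use A in \<open>auto simp: emeasure_return\<close>)
  qed
qed simp

text \<open>Every point other than \<open>x\<close> has the open null neighbourhood
  \<open>- {x}\<close>.\<close>

lemma measure_support_dirac:
  fixes x :: "'k::t2_space"
  shows "measure_support (return borel x) = {x}"
proof (intro equalityI subsetI)
  fix y
  assume y: "y \<in> measure_support (return borel x)"
  have "emeasure (return borel x) (- {x}) = 0"
    by (simp add: emeasure_return)
  then show "y \<in> {x}"
    using y by (auto simp: measure_support_def dest!: spec[of _ "- {x}"])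
qed (auto simp: measure_support_def emeasure_return)

lemma bcontfun_borel_measurable:
  fixes f :: "'k::topological_space \<Rightarrow>\<^sub>C complex"
  shows "apply_bcontfun f \<in> borel_measurable borel"
  by (intro borel_measurable_continuous_onI continuous_intros) auto

text \<open>An average over a probability space that reaches the pointwise upper bound of its
  integrand forces equality almost everywhere, hence at some point.\<close>

lemma ex_norm_mult_eq_of_integral:
  fixes f g :: "'k::topological_space \<Rightarrow>\<^sub>C complex"
  assumes "prob_space M"
    and sets: "sets M = sets borel"
    and eq: "cmod (\<integral>x. cnj (f x) * g x \<partial>M) = norm f * norm g"
  shows "\<exists>x. cmod (f x) * cmod (g x) = norm f * norm g"
proof -
  interpret prob_space M by fact
  have [measurable]: "apply_bcontfun f \<in> borel_measurable M" "apply_bcontfun g \<in> borel_measurable M"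
    using bcontfun_borel_measurable measurable_cong_sets[OF sets refl] by blast+
  have le: "cmod (f x) * cmod (g x) \<le> norm f * norm g" for x
    by (intro mult_mono norm_bounded) auto
  have int: "integrable M (\<lambda>x. cmod (f x) * cmod (g x))"
    by (rule integrable_const_bound[of _ "norm f * norm g"]) (use le in auto)
  have "norm f * norm g \<le> (\<integral>x. cmod (f x) * cmod (g x) \<partial>M)"
    unfolding eq[symmetric]
    using integral_norm_bound[of M "\<lambda>x. cnj (f x) * g x"] by (simp add: norm_mult)
  \<comment> \<open>Total mass 1 makes the constant integrate to itself. The deficit is nonnegative,
    so its vanishing integral makes it zero almost everywhere.\<close>
  then have "(\<integral>x. norm f * norm g - cmod (f x) * cmod (g x) \<partial>M) \<le> 0"
    using int by (simp add: prob_space)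
  moreover have "0 \<le> (\<integral>x. norm f * norm g - cmod (f x) * cmod (g x) \<partial>M)"
    by (rule Bochner_Integration.integral_nonneg) (use le in auto)
  ultimately have "(\<integral>x. norm f * norm g - cmod (f x) * cmod (g x) \<partial>M) = 0"
    by linarith
  then have "AE x in M. norm f * norm g - cmod (f x) * cmod (g x) = 0"
    by (subst (asm) integral_nonneg_eq_0_iff_AE) (use int le in auto)
  then have "AE x in M. cmod (f x) * cmod (g x) = norm f * norm g"
    by eventually_elim simp
  \<comment> \<open>Since the whole space is not null, a property that holds almost everywhere has a
    witness.\<close>
  moreover have "ae_filter M \<noteq> bot"
    using AE_False by (simp add: trivial_limit_def)
  ultimately show ?thesis
    using eventually_happens' by blast
qed

text \<open>If both norms are positive, neither factor can fall short of its maximum, and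
  \<open>x\<close> itself is the common point. If one function is zero, it attains its norm
  everywhere, and a maximum point of the other, possibly different from \<open>x\<close>,
  serves.\<close>

lemma common_max_of_norm_mult_eq:
  fixes f g :: "'k::t2_space \<Rightarrow>\<^sub>C complex"
  assumes "compact (UNIV :: 'k set)" and eq: "cmod (f x) * cmod (g x) = norm f * norm g"
  shows "\<exists>x. cmod (f x) = norm f \<and> cmod (g x) = norm g"
proof -
  consider "f = 0" | "g = 0" | "norm f > 0" "norm g > 0"
    by auto
  then show ?thesis
  proof cases
    case 3
    have le: "cmod (f x) \<le> norm f" "cmod (g x) \<le> norm g"
      by (rule norm_bounded)+
    have "\<not> cmod (f x) < norm f"
    proof
      assume "cmod (f x) < norm f"
      then have "cmod (f x) * norm g < norm f * norm g"
        using 3(2) by (rule mult_strict_right_mono)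
      moreover have "cmod (f x) * cmod (g x) \<le> cmod (f x) * norm g"
        using le(2) by (rule mult_left_mono) simp
      ultimately show False using eq by simp
    qed
    then have "cmod (f x) = norm f"
      using le by simp
    \<comment> \<open>Cancelling the positive factor \<open>norm f\<close> in \<open>eq\<close>
      gives the equality for \<open>g\<close>.\<close>
    with eq 3 show ?thesis by auto
  qed (use norm_bcontfun_is_max[OF assms(1), of f] norm_bcontfun_is_max[OF assms(1), of g] in auto)
qed

theorem theorem2p5:
  fixes f g :: "'k::t2_space \<Rightarrow>\<^sub>C complex"
  assumes "compact (UNIV :: 'k set)"
  shows "(\<exists>\<mu> :: 'k measure.
            prob_space \<mu> \<and> regular_borel_measure \<mu> \<and>
            measure_support \<mu> \<subseteq> norm_attaining_set f \<and>
            cmod (\<integral>x. cnj (f x) * g x \<partial>\<mu>) = norm f * norm g)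
         \<longleftrightarrow> f \<parallel> g"
  unfolding norm_parallel_iff_common_max[OF assms]
proof
  assume "\<exists>\<mu> :: 'k measure.
            prob_space \<mu> \<and> regular_borel_measure \<mu> \<and>
            measure_support \<mu> \<subseteq> norm_attaining_set f \<and>
            cmod (\<integral>x. cnj (f x) * g x \<partial>\<mu>) = norm f * norm g"
  then obtain x where "cmod (f x) * cmod (g x) = norm f * norm g"
    using ex_norm_mult_eq_of_integral unfolding regular_borel_measure_def by blast
  then show "\<exists>x. cmod (f x) = norm f \<and> cmod (g x) = norm g"
    by (rule common_max_of_norm_mult_eq[OF assms])
next
  assume "\<exists>x. cmod (f x) = norm f \<and> cmod (g x) = norm g"
  then obtain x where x: "cmod (f x) = norm f" "cmod (g x) = norm g"
    by blast
  \<comment> \<open>Measurability lets the integral against the Dirac measure be evaluated at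
    \<open>x\<close>.\<close>
  have "(\<lambda>y. cnj (f y) * g y) \<in> borel_measurable borel"
    by (intro borel_measurable_continuous_onI continuous_intros) auto
  then have "(\<integral>y. cnj (f y) * g y \<partial>return borel x) = cnj (f x) * g x"
    by (intro integral_return) auto
  then have "cmod (\<integral>y. cnj (f y) * g y \<partial>return borel x) = norm f * norm g"
    using x by (simp add: norm_mult)
  moreover have "prob_space (return borel x)"
    by (rule prob_space_return) simp
  moreover have "measure_support (return borel x) \<subseteq> norm_attaining_set f"
    using x by (simp add: measure_support_dirac norm_attaining_set_def)
  ultimately show "\<exists>\<mu> :: 'k measure.
            prob_space \<mu> \<and> regular_borel_measure \<mu> \<and>
            measure_support \<mu> \<subseteq> norm_attaining_set f \<and>
            cmod (\<integral>x. cnj (f x) * g x \<partial>\<mu>) = norm f * norm g"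
    using regular_borel_measure_dirac[of x] by blast
qed

end
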